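(* Let $f$, $M$, $l_f$, $L_M$ satisfy A1) and A2), and let $0=t_0<t_1<\dots<t_N=T$ be a grid with step-sizes $h_n=t_{n+1}-t_n$ satisfying A3). Then for any sequence $\{x_n\}_{n=0}^N\subset\mathbb{R}^d$ and any initial value $y_0\in\mathbb{R}^d$, there exists a sequence $\{y_n\}_{n=0}^N$ starting at $y_0$ with $y_{n+1}\in\Phi(t_n,y_n;h_n)$ for $n=0,\dots,N-1$ such that, for all $n=0,\dots,N$, $$|x_n-y_n|\le e^{\sum_{k=0}^{n-1}\left(\frac{l_f(t_{k+1})h_k}{1-l_f(t_{k+1})h_k}+L_M(t_k)h_k\right)}|x_0-y_0|+\sum_{k=0}^{n-1}e^{\sum_{j=k}^{n-1}\frac{l_f(t_{j+1})h_j}{1-l_f(t_{j+1})h_j}+\sum_{j=k+1}^{n-1}L_M(t_j)h_j}\,h_k\,g_k,$$ where $g_n:=\operatorname{dist}\left(\tfrac{1}{h_n}(x_{n+1}-x_n),\,f(t_{n+1},x_{n+1})+M(t_n,x_n)\right)$ for $n=0,\dots,N-1$.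
   Context: $|\cdot|$ is the Euclidean norm on $\mathbb{R}^d$. For a point $a$ and a nonempty compact set $B\subset\mathbb{R}^d$, $\operatorname{dist}(a,B)=\inf_{b\in B}|a-b|$; for nonempty compact $A,B$, $\operatorname{dist}(A,B)=\sup_{a\in A}\inf_{b\in B}|a-b|$ and $\operatorname{dist}_H(A,B)=\max\{\operatorname{dist}(A,B),\operatorname{dist}(B,A)\}$. Let $T>0$. A1) $f:[0,T]\times\mathbb{R}^d\to\mathbb{R}^d$ is continuous and there is a continuous function $l_f:[0,T]\to\mathbb{R}$ such that $\langle f(t,x)-f(t,x'),x-x'\rangle\le l_f(t)|x-x'|^2$ for all $t\in[0,T]$, $x,x'\in\mathbb{R}^d$. A2) $M:[0,T]\times\mathbb{R}^d\to\{\text{nonempty convex compact subsets of }\mathbb{R}^d\}$ is continuous with respect to the Hausdorff metric and there is a continuous function $L_M:[0,T]\to[0,\infty)$ such that $\operatorname{dist}_H(M(t,x),M(t,x'))\le L_M(t)|x-x'|$ for all $t\in[0,T]$, $x,x'\in\mathbb{R}^d$. A3) $l_f(t_{n+1})h_n<1$ for all $n\in\{0,\dots,N-1\}$. The parameterized semi-implicit Euler scheme is the set-valued map $\Phi(t,x;h)=\{z\in\mathbb{R}^d: z\in x+hf(t+h,z)+hM(t,x)\}$. Empty sums are zero. *)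

theory Defs
  imports "HOL-Analysis.Analysis"
begin

text \<open>
  The distance of a point \<open>a\<close> to a nonempty set \<open>B\<close> is the library's \<^term>\<open>infdist a B\<close>.
  The two notions below are only meant for nonempty compact arguments,
  for which the suprema and infima involved are attained.
\<close>

definition hausdorff_semidist :: "'a::metric_space set \<Rightarrow> 'a set \<Rightarrow> real" where
  "hausdorff_semidist A B = (SUP a\<in>A. infdist a B)"

definition hausdorff_dist :: "'a::metric_space set \<Rightarrow> 'a set \<Rightarrow> real" where
  "hausdorff_dist A B = max (hausdorff_semidist A B) (hausdorff_semidist B A)"

definition hausdorff_continuous_on ::
    "'a::topological_space set \<Rightarrow> ('a \<Rightarrow> 'b::metric_space set) \<Rightarrow> bool" where
  "hausdorff_continuous_on S F \<longleftrightarrow>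
     (\<forall>p\<in>S. ((\<lambda>q. hausdorff_dist (F q) (F p)) \<longlongrightarrow> 0) (at p within S))"

definition semi_implicit_euler ::
    "(real \<Rightarrow> 'a \<Rightarrow> 'a) \<Rightarrow> (real \<Rightarrow> 'a \<Rightarrow> 'a set) \<Rightarrow> real \<Rightarrow> 'a \<Rightarrow> real \<Rightarrow> 'a::real_normed_vector set"
  where
  "semi_implicit_euler f M t x h =
     {z. z \<in> (\<lambda>m. x + h *\<^sub>R f (t + h) z + h *\<^sub>R m) ` M t x}"

end

theory Submission
  imports Defs
begin

text \<open>
  The one-sided Lipschitz condition and the step-size bound make \<open>z \<mapsto> z - h f(t + h, z)\<close> strongly
  monotone, hence bijective. So for each \<open>m \<in> M(t, y)\<close> the scheme has exactly one solution
  with velocity \<open>m\<close>. Choosing for \<open>m\<close> the point of \<open>M(t\<^sub>n, y\<^sub>n)\<close> nearest to the element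
  of \<open>M(t\<^sub>n, x\<^sub>n)\<close> that realizes the defect \<open>g\<^sub>n\<close> gives a one-step error estimate, and
  the bounds \<open>1 / (1 - l h) = 1 + l h / (1 - l h) \<le> exp (l h / (1 - l h))\<close> and
  \<open>1 + L h \<le> exp (L h)\<close> turn it into a recursion solved by a discrete Gronwall inequality.
\<close>

lemma strongly_monotone_norm_le:
  fixes F :: "'a::real_inner \<Rightarrow> 'a"
  assumes "\<And>u v. c * (norm (u - v))\<^sup>2 \<le> (F u - F v) \<bullet> (u - v)"
  shows "c * norm (u - v) \<le> norm (F u - F v)"
proof (cases "u = v")
  case False
  have "c * norm (u - v) * norm (u - v) \<le> norm (F u - F v) * norm (u - v)"
    using assms[of u v] norm_cauchy_schwarz[of "F u - F v" "u - v"]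
    by (simp add: power2_eq_square mult.assoc)
  with False show ?thesis
    by simp
qed simp

text \<open>Strong monotonicity makes \<open>F\<close> expand distances by at least the factor
  \<open>c\<close>. Hence \<open>F\<close> is injective and its range is open by invariance of
  domain. Convergent sequences in the range have Cauchy preimages, so the range is also closed, and
  connectedness of the space leaves only the whole space.\<close>

lemma strongly_monotone_surj:
  fixes F :: "'a::euclidean_space \<Rightarrow> 'a"
  assumes cont: "continuous_on UNIV F"
    and c: "c > 0"
    and mono: "\<And>u v. c * (norm (u - v))\<^sup>2 \<le> (F u - F v) \<bullet> (u - v)"
  shows "surj F"
proof -
  have expand: "c * dist u v \<le> dist (F u) (F v)" for u v
    using strongly_monotone_norm_le[of c F, OF mono] by (simp add: dist_norm)
  have "inj F"
  proof (rule injI)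
    fix u v assume "F u = F v"
    with expand[of u v] c show "u = v"
      by (simp add: mult_le_0_iff)
  qed
  with cont have "open (range F)"
    by (rule invariance_of_domain[OF _ open_UNIV])
  moreover have "closed (range F)"
    unfolding closed_sequential_limits
  proof (intro allI impI)
    fix w l assume "(\<forall>n. w n \<in> range F) \<and> w \<longlonglongrightarrow> l"
    then have "\<forall>n. \<exists>u. w n = F u" and lim: "w \<longlonglongrightarrow> l"
      by auto
    then obtain u where u: "\<And>n. w n = F (u n)"
      by metis
    have "Cauchy w"
      using lim by (rule LIMSEQ_imp_Cauchy)
    have "Cauchy u"
    proof (rule metric_CauchyI)
      fix e :: real assume "e > 0"
      with c have "c * e > 0"
        by simp
      with \<open>Cauchy w\<close> obtain K where K: "\<And>m n. m \<ge> K \<Longrightarrow> n \<ge> K \<Longrightarrow> dist (w m) (w n) < c * e"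
        by (meson metric_CauchyD)
      have "dist (u m) (u n) < e" if "m \<ge> K" "n \<ge> K" for m n
      proof -
        have "c * dist (u m) (u n) < c * e"
          using K[OF that] expand[of "u m" "u n"] unfolding u by (rule le_less_trans[rotated])
        with c show ?thesis
          by simp
      qed
      then show "\<exists>K. \<forall>m\<ge>K. \<forall>n\<ge>K. dist (u m) (u n) < e"
        by blast
    qed
    then obtain a where "u \<longlonglongrightarrow> a"
      by (auto simp: Cauchy_convergent_iff convergent_def)
    then have "w \<longlonglongrightarrow> F a"
      unfolding u using continuous_on_tendsto_compose[OF cont] by simp
    with lim have "l = F a"
      by (rule LIMSEQ_unique)
    then show "l \<in> range F"
      by simp
  qed
  ultimately show ?thesis
    using clopen[of "range F"] by simp
qed

text \<open>Compactness of \<open>A\<close> bounds the distances from above, so that the real-valued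
  \<open>SUP\<close> in \<open>hausdorff_semidist\<close> really is an upper bound.\<close>

lemma infdist_le_hausdorff_dist:
  assumes "compact A" "B \<noteq> {}" "a \<in> A"
  shows "infdist a B \<le> hausdorff_dist A B"
proof -
  have "compact ((\<lambda>a. infdist a B) ` A)"
    using assms by (intro compact_continuous_image continuous_intros)
  then have "bdd_above ((\<lambda>a. infdist a B) ` A)"
    by (intro bounded_imp_bdd_above compact_imp_bounded)
  with \<open>a \<in> A\<close> have "infdist a B \<le> hausdorff_semidist A B"
    unfolding hausdorff_semidist_def by (rule cSUP_upper)
  then show ?thesis
    unfolding hausdorff_dist_def by simp
qed

text \<open>One step of the scheme with the times frozen: \<open>p\<close> stands for
  \<open>f (t + h)\<close>, \<open>A\<close> for \<open>M t x\<close>, \<open>B\<close> for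
  \<open>M t y\<close>, and \<open>x'\<close> for the given successor of \<open>x\<close>. The
  \<open>infdist\<close> term is the defect of the given sequence.\<close>

lemma implicit_euler_step:
  fixes p :: "'a::euclidean_space \<Rightarrow> 'a"
  assumes cont: "continuous_on UNIV p"
    and osl: "\<And>u v. (p u - p v) \<bullet> (u - v) \<le> l * (norm (u - v))\<^sup>2"
    and h: "h > 0" "l * h < 1"
    and A: "compact A" "A \<noteq> {}"
    and B: "compact B" "B \<noteq> {}"
    and AB: "hausdorff_dist A B \<le> K"
  obtains z m where "m \<in> B" "z = y + h *\<^sub>R p z + h *\<^sub>R m"
    "(1 - l * h) * norm (x' - z) \<le>
      norm (x - y) + h * K + h * infdist ((1 / h) *\<^sub>R (x' - x)) ((\<lambda>a. p x' + a) ` A)"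
proof -
  define F where "F u = u - h *\<^sub>R p u" for u
  have mono: "(1 - l * h) * (norm (u - v))\<^sup>2 \<le> (F u - F v) \<bullet> (u - v)" for u v
  proof -
    have "(F u - F v) \<bullet> (u - v) = (norm (u - v))\<^sup>2 - h * ((p u - p v) \<bullet> (u - v))"
      by (simp add: F_def power2_norm_eq_inner algebra_simps)
    moreover have "h * ((p u - p v) \<bullet> (u - v)) \<le> h * (l * (norm (u - v))\<^sup>2)"
      using osl h by simp
    ultimately show ?thesis
      by (simp add: algebra_simps)
  qed
  have "continuous_on UNIV F"
    unfolding F_def by (intro continuous_intros cont)
  then have surj: "surj F"
    using strongly_monotone_surj[OF _ _ mono] h by simp
  let ?A = "(\<lambda>a. p x' + a) ` A" and ?q = "(1 / h) *\<^sub>R (x' - x)"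
  have "closed ?A" "?A \<noteq> {}"
    using A by (auto intro!: compact_imp_closed compact_continuous_image continuous_intros)
  then obtain a where a: "a \<in> A" "infdist ?q ?A = dist ?q (p x' + a)"
    using infdist_attains_inf[of ?A ?q] by auto
  obtain m where m: "m \<in> B" "infdist a B = dist a m"
    using infdist_attains_inf[of B a] B compact_imp_closed by auto
  \<comment> \<open>With velocity \<open>m\<close>, the implicit equation for the next iterate
    \<open>z\<close> is exactly \<open>F z = y + h *\<^sub>R m\<close>.\<close>
  obtain z where z: "F z = y + h *\<^sub>R m"
    using surj by (metis surjD)
  have "x' - x = h *\<^sub>R ?q"
    using h by simp
  \<comment> \<open>The three summands are the old error, the gap between the two velocities, and
    the defect. The strong monotonicity of \<open>F\<close> carries their bound over to
    \<open>x' - z\<close>.\<close>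
  then have "F x' - F z = (x - y) + h *\<^sub>R (a - m) + h *\<^sub>R (?q - (p x' + a))"
    unfolding z unfolding F_def by (simp add: algebra_simps)
  then have "norm (F x' - F z) \<le> norm (x - y) + norm (h *\<^sub>R (a - m)) + norm (h *\<^sub>R (?q - (p x' + a)))"
    by (metis norm_triangle_ineq norm_triangle_mono order_refl)
  also have "\<dots> = norm (x - y) + h * dist a m + h * infdist ?q ?A"
    using h a by (simp add: dist_norm)
  also have "dist a m \<le> K"
    using infdist_le_hausdorff_dist[OF A(1) B(2) a(1)] m(2) AB by simp
  finally have "(1 - l * h) * norm (x' - z) \<le> norm (x - y) + h * K + h * infdist ?q ?A"
    using strongly_monotone_norm_le[of "1 - l * h" F, OF mono, of x' z] h by simp
  moreover have "z = y + h *\<^sub>R p z + h *\<^sub>R m"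
    using z by (simp add: F_def algebra_simps)
  ultimately show ?thesis
    using that m(1) by blast
qed

text \<open>Negative \<open>s\<close> must be covered, because \<open>l_f\<close> may take negative
  values.\<close>

lemma inverse_one_minus_le_exp:
  fixes s :: real
  assumes "s < 1"
  shows "1 / (1 - s) \<le> exp (s / (1 - s))"
proof -
  have "1 / (1 - s) = 1 + s / (1 - s)"
    using assms by (simp add: field_simps)
  then show ?thesis
    using exp_ge_add_one_self by simp
qed

text \<open>The implicit factor \<open>exp (a n)\<close> also hits the fresh term
  \<open>c n\<close>, whereas \<open>exp (b n)\<close> hits only the old error. This is why the sum
  of \<open>a\<close> starts at \<open>k\<close> and that of \<open>b\<close> at
  \<open>Suc k\<close>.\<close>

lemma discrete_gronwall_exp:
  fixes e a b c :: "nat \<Rightarrow> real"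
  assumes "\<And>n. n < N \<Longrightarrow> e (Suc n) \<le> exp (a n) * (exp (b n) * e n + c n)"
    and "n \<le> N"
  shows "e n \<le> exp (\<Sum>k<n. a k + b k) * e 0
    + (\<Sum>k<n. exp ((\<Sum>j=k..<n. a j) + (\<Sum>j=Suc k..<n. b j)) * c k)"
  using \<open>n \<le> N\<close>
proof (induction n)
  case (Suc n)
  let ?S = "\<lambda>n k. exp ((\<Sum>j=k..<n. a j) + (\<Sum>j=Suc k..<n. b j)) * c k"
  \<comment> \<open>All old terms gain the same factor; the new term \<open>k = n\<close> has an
    empty \<open>b\<close>-sum and contributes \<open>exp (a n) * c n\<close>.\<close>
  have "?S (Suc n) k = exp (a n + b n) * ?S n k" if "k < n" for k
    using that by (simp add: exp_add algebra_simps)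
  then have sum: "(\<Sum>k<Suc n. ?S (Suc n) k) = exp (a n + b n) * (\<Sum>k<n. ?S n k) + exp (a n) * c n"
    unfolding sum_distrib_left sum.lessThan_Suc by (intro arg_cong2[of _ _ _ _ "(+)"] sum.cong) auto
  have "e (Suc n) \<le> exp (a n) * (exp (b n) * e n + c n)"
    using assms(1) Suc.prems by simp
  also have "\<dots> = exp (a n + b n) * e n + exp (a n) * c n"
    by (simp add: exp_add algebra_simps)
  also have "\<dots> \<le> exp (a n + b n) * (exp (\<Sum>k<n. a k + b k) * e 0 + (\<Sum>k<n. ?S n k))
      + exp (a n) * c n"
    using Suc by simp
  also have "\<dots> = exp (\<Sum>k<Suc n. a k + b k) * e 0 + (\<Sum>k<Suc n. ?S (Suc n) k)"
    unfolding sum by (simp add: exp_add algebra_simps)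
  finally show ?case .
qed simp

theorem proposition15:
  fixes T :: real
    and f :: "real \<Rightarrow> real ^ 'd \<Rightarrow> real ^ 'd"
    and M :: "real \<Rightarrow> real ^ 'd \<Rightarrow> (real ^ 'd) set"
    and l_f L_M :: "real \<Rightarrow> real"
    and N :: nat
    and t h g :: "nat \<Rightarrow> real"
    and x :: "nat \<Rightarrow> real ^ 'd"
    and y0 :: "real ^ 'd"
  assumes T_pos: "T > 0"
    and f_cont: "continuous_on ({0..T} \<times> UNIV) (\<lambda>(s, u). f s u)"
    and l_f_cont: "continuous_on {0..T} l_f"
    and f_osl: "\<And>s u u'. s \<in> {0..T} \<Longrightarrow>
          (f s u - f s u') \<bullet> (u - u') \<le> l_f s * (norm (u - u'))\<^sup>2"
    and M_values: "\<And>s u. s \<in> {0..T} \<Longrightarrow>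
          M s u \<noteq> {} \<and> convex (M s u) \<and> compact (M s u)"
    and M_cont: "hausdorff_continuous_on ({0..T} \<times> UNIV) (\<lambda>(s, u). M s u)"
    and L_M_cont: "continuous_on {0..T} L_M"
    and L_M_nonneg: "\<And>s. s \<in> {0..T} \<Longrightarrow> 0 \<le> L_M s"
    and M_lipschitz: "\<And>s u u'. s \<in> {0..T} \<Longrightarrow>
          hausdorff_dist (M s u) (M s u') \<le> L_M s * norm (u - u')"
    and grid_start: "t 0 = 0"
    and grid_end: "t N = T"
    and grid_less: "\<And>n. n < N \<Longrightarrow> t n < t (Suc n)"
    and h_eq: "\<And>n. n < N \<Longrightarrow> h n = t (Suc n) - t n"
    and step_bound: "\<And>n. n < N \<Longrightarrow> l_f (t (Suc n)) * h n < 1"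
    and g_eq: "\<And>n. n < N \<Longrightarrow>
          g n = infdist ((1 / h n) *\<^sub>R (x (Suc n) - x n))
                  ((\<lambda>m. f (t (Suc n)) (x (Suc n)) + m) ` M (t n) (x n))"
  shows "\<exists>y :: nat \<Rightarrow> real ^ 'd.
           y 0 = y0 \<and>
           (\<forall>n<N. y (Suc n) \<in> semi_implicit_euler f M (t n) (y n) (h n)) \<and>
           (\<forall>n\<le>N. norm (x n - y n) \<le>
              exp (\<Sum>k<n. l_f (t (Suc k)) * h k / (1 - l_f (t (Suc k)) * h k) + L_M (t k) * h k)
                * norm (x 0 - y0)
              + (\<Sum>k<n. exp ((\<Sum>j=k..<n. l_f (t (Suc j)) * h j / (1 - l_f (t (Suc j)) * h j))
                              + (\<Sum>j=Suc k..<n. L_M (t j) * h j))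
                         * h k * g k))"
proof -
  define a where "a n = l_f (t (Suc n)) * h n / (1 - l_f (t (Suc n)) * h n)" for n
  define b where "b n = L_M (t n) * h n" for n
  have t_le: "t m \<le> t n" if "m \<le> n" "n \<le> N" for m n
    using that
  proof (induction n rule: dec_induct)
    case (step n)
    then show ?case
      using grid_less[of n] by simp
  qed simp
  \<comment> \<open>Monotonicity keeps every node in the interval where the assumptions on
    \<open>f\<close> and \<open>M\<close> are available.\<close>
  have t_in: "t n \<in> {0..T}" if "n \<le> N" for n
    using t_le[of 0 n] t_le[of n N] grid_start grid_end that by auto
  have h_pos: "h n > 0" if "n < N" for n
    using grid_less h_eq that by simp
  \<comment> \<open>The estimate is proved for every \<open>y\<close>, since the trajectory is only
    built afterwards by dependent choice.\<close>
  have step: "\<exists>z. z \<in> semi_implicit_euler f M (t n) y (h n) \<and>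
      norm (x (Suc n) - z) \<le> exp (a n) * (exp (b n) * norm (x n - y) + h n * g n)"
    if n: "n < N" for n y
  proof -
    let ?s = "t (Suc n)"
    have s: "t n \<in> {0..T}" "?s \<in> {0..T}" and h: "h n > 0" "l_f ?s * h n < 1"
      using t_in h_pos step_bound n by auto
    have cont: "continuous_on UNIV (f ?s)"
      using continuous_on_compose2[OF f_cont, of UNIV "Pair ?s"] s(2)
      by (force intro: continuous_intros)
    obtain z m where zm: "m \<in> M (t n) y" "z = y + h n *\<^sub>R f ?s z + h n *\<^sub>R m"
      and le: "(1 - l_f ?s * h n) * norm (x (Suc n) - z) \<le>
        norm (x n - y) + h n * (L_M (t n) * norm (x n - y)) + h n * g n"
      using implicit_euler_step[OF cont f_osl[OF s(2)] h _ _ _ _ M_lipschitz[OF s(1)],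
          of "x n" y y "x (Suc n)" "x n"] M_values[OF s(1)] g_eq[OF n] by metis
    \<comment> \<open>The sign of the defect is needed to enlarge both factors of the product below
      at once.\<close>
    have g: "0 \<le> h n * g n"
      using h g_eq[OF n] by (simp add: infdist_nonneg)
    have "norm (x (Suc n) - z) \<le>
        1 / (1 - l_f ?s * h n) * ((1 + b n) * norm (x n - y) + h n * g n)"
      using le h by (simp add: b_def field_simps)
    also have "\<dots> \<le> exp (a n) * (exp (b n) * norm (x n - y) + h n * g n)"
    proof (rule mult_mono)
      show "1 / (1 - l_f ?s * h n) \<le> exp (a n)"
        unfolding a_def by (rule inverse_one_minus_le_exp[OF h(2)])
      show "(1 + b n) * norm (x n - y) + h n * g n \<le> exp (b n) * norm (x n - y) + h n * g n"
        using exp_ge_add_one_self[of "b n"] by (intro add_right_mono mult_right_mono) auto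
      have "0 \<le> b n"
        using L_M_nonneg[OF s(1)] h by (simp add: b_def)
      with g show "0 \<le> (1 + b n) * norm (x n - y) + h n * g n"
        by simp
    qed simp
    \<comment> \<open>By \<open>h_eq\<close>, the time \<open>t n + h n\<close> at which the scheme
      evaluates \<open>f\<close> is the node \<open>?s\<close>.\<close>
    finally show ?thesis
      using zm h_eq[OF n] unfolding semi_implicit_euler_def by auto
  qed
  \<comment> \<open>The choice principle yields a sequence on all naturals; the guard
    \<open>n < N\<close> leaves the values beyond \<open>N\<close> unconstrained.\<close>
  have "\<exists>y. \<forall>n. (n = 0 \<longrightarrow> y n = y0) \<and> (n < N \<longrightarrow>
      y (Suc n) \<in> semi_implicit_euler f M (t n) (y n) (h n) \<and>
      norm (x (Suc n) - y (Suc n)) \<le> exp (a n) * (exp (b n) * norm (x n - y n) + h n * g n))"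
    using dependent_nat_choice[of "\<lambda>n u. n = 0 \<longrightarrow> u = y0"
        "\<lambda>n u v. n < N \<longrightarrow> v \<in> semi_implicit_euler f M (t n) u (h n) \<and>
          norm (x (Suc n) - v) \<le> exp (a n) * (exp (b n) * norm (x n - u) + h n * g n)"] step
    by blast
  then obtain y where y0: "y 0 = y0"
    and scheme: "\<forall>n<N. y (Suc n) \<in> semi_implicit_euler f M (t n) (y n) (h n)"
    and err: "\<And>n. n < N \<Longrightarrow>
      norm (x (Suc n) - y (Suc n)) \<le> exp (a n) * (exp (b n) * norm (x n - y n) + h n * g n)"
    by blast
  have "norm (x n - y n) \<le> exp (\<Sum>k<n. a k + b k) * norm (x 0 - y 0)
    + (\<Sum>k<n. exp ((\<Sum>j=k..<n. a j) + (\<Sum>j=Suc k..<n. b j)) * (h k * g k))" if "n \<le> N" for n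
    using discrete_gronwall_exp[of N "\<lambda>n. norm (x n - y n)", OF err that] .
  then show ?thesis
    using y0 scheme unfolding a_def b_def mult.assoc[symmetric] by blast
qed

end
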